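(* Let $K$ be any non-empty compact convex subset of a locally convex real space $\mathcal{X}$ and let $h:K\rightarrow[\mathrm{k},\infty]$ be any extended real-valued function, with $\mathrm{k}\in\mathbb{R}$. Let $M$ be the (compact convex) set of minimizers of $\Gamma(h)$ over $K$. Then the extreme points of $M$ belong to the set of generalized minimizers of $h$, i.e. $$\mathcal{E}(M)\subseteq\overline{\Omega(h,K)}.$$
   Context: Topological vector spaces are assumed to be Hausdorff; a locally convex real space is a real, Hausdorff, locally convex topological vector space. For a set $K$ and $h:K\to(-\infty,\infty]$, $\inf h(K):=\inf_{x\in K}h(x)$. Define $$\Omega(h,K):=\Big\{x\in K:\ \exists \text{ a net } \{x_i\}_{i\in I}\subset K \text{ with } x_i\to x \text{ and } \lim_I h(x_i)=\inf h(K)\Big\}.$$ The set of generalized minimizers of $h$ is the closure $\overline{\Omega(h,K)}\subset K$ of this set. Let $\mathrm{A}(\mathcal{X})$ be the space of all affine continuous real-valued functions on $\mathcal{X}$. The $\Gamma$-regularization of $h$ on $K$ is the function defined, for all $x\in K$, by $$\Gamma(h)(x):=\sup\{m(x): m\in \mathrm{A}(\mathcal{X}) \text{ and } m|_K\leq h\}.$$ $\mathcal{E}(M)$ denotes the set of extreme points of the convex set $M$. *)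

theory Defs
  imports "HOL-Analysis.Analysis"
begin

text \<open>Real Hausdorff locally convex topological vector spaces. The class
  \<^class>\<open>topological_ab_group_add\<close> supplies continuity of addition and negation, and
  \<open>tendsto_scaleR_Pair\<close> is joint continuity of scalar multiplication, in the style of the library
  axiom \<open>tendsto_add_Pair\<close>. The class specification cannot mention the constant \<^const>\<open>convex\<close>,
  so \<open>locally_convex_0_raw\<close> has its definition unfolded; see \<open>locally_convex_0\<close>.\<close>

class locally_convex_space = real_vector + topological_ab_group_add + t2_space +
  assumes tendsto_scaleR_Pair:
    "LIM p (nhds r \<times>\<^sub>F nhds a). fst p *\<^sub>R snd p :> nhds (r *\<^sub>R a)"
  assumes locally_convex_0_raw:
    "open U \<Longrightarrow> 0 \<in> U \<Longrightarrow> \<exists>V. open V \<and>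
       (\<forall>x\<in>V. \<forall>y\<in>V. \<forall>u\<ge>0. \<forall>v\<ge>0. u + v = 1 \<longrightarrow> u *\<^sub>R x + v *\<^sub>R y \<in> V) \<and> 0 \<in> V \<and> V \<subseteq> U"

lemma locally_convex_0:
  fixes U :: "'a::locally_convex_space set"
  assumes "open U" "0 \<in> U"
  shows "\<exists>V. open V \<and> convex V \<and> 0 \<in> V \<and> V \<subseteq> U"
  unfolding convex_def using assms by (rule locally_convex_0_raw)

instance real_normed_vector \<subseteq> locally_convex_space
proof
  fix r :: real and a :: 'a
  show "LIM p (nhds r \<times>\<^sub>F nhds a). fst p *\<^sub>R snd p :> nhds (r *\<^sub>R a)"
    unfolding nhds_prod[symmetric]
    using tendsto_scaleR[OF tendsto_fst[OF filterlim_ident] tendsto_snd[OF filterlim_ident], of "(r, a)"]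
    by simp
next
  fix U :: "'a set"
  assume "open U" "0 \<in> U"
  then obtain e where "e > 0" "ball 0 e \<subseteq> U"
    by (meson openE)
  then show "\<exists>V. open V \<and>
      (\<forall>x\<in>V. \<forall>y\<in>V. \<forall>u\<ge>0. \<forall>v\<ge>0. u + v = 1 \<longrightarrow> u *\<^sub>R x + v *\<^sub>R y \<in> V) \<and> 0 \<in> V \<and> V \<subseteq> U"
    unfolding convex_def[symmetric]
    by (intro exI[of _ "ball 0 e"]) auto
qed

text \<open>A net is a family \<open>X\<close> indexed by a non-empty directed preordered set \<open>(I, le)\<close>. Its
  convergence is convergence along the filter generated by the tails of \<open>I\<close>.\<close>

definition directed_set :: "'i set \<Rightarrow> ('i \<Rightarrow> 'i \<Rightarrow> bool) \<Rightarrow> bool" where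
  "directed_set I le \<longleftrightarrow> I \<noteq> {} \<and> reflp_on I le \<and> transp_on I le \<and>
     (\<forall>i\<in>I. \<forall>j\<in>I. \<exists>k\<in>I. le i k \<and> le j k)"

definition tails :: "'i set \<Rightarrow> ('i \<Rightarrow> 'i \<Rightarrow> bool) \<Rightarrow> 'i filter" where
  "tails I le = (INF i\<in>I. principal {j \<in> I. le i j})"

lemma eventually_tails:
  assumes "directed_set I le"
  shows "eventually P (tails I le) \<longleftrightarrow> (\<exists>i\<in>I. \<forall>j\<in>I. le i j \<longrightarrow> P j)"
proof -
  have ne: "I \<noteq> {}" and tr: "transp_on I le"
    and dir: "\<And>i j. i \<in> I \<Longrightarrow> j \<in> I \<Longrightarrow> \<exists>k\<in>I. le i k \<and> le j k"
    using assms by (auto simp: directed_set_def)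
  have "\<exists>k\<in>I. principal {l \<in> I. le k l} \<le> inf (principal {l \<in> I. le i l}) (principal {l \<in> I. le j l})"
    if ij: "i \<in> I" "j \<in> I" for i j
  proof -
    obtain k where k: "k \<in> I" "le i k" "le j k"
      using dir[OF ij] by auto
    have "{l \<in> I. le k l} \<subseteq> {l \<in> I. le i l} \<inter> {l \<in> I. le j l}"
      using transp_onD[OF tr ij(1) k(1) _ k(2)] transp_onD[OF tr ij(2) k(1) _ k(3)] by fast
    then show ?thesis
      using k(1) by (intro bexI[of _ k]) simp_all
  qed
  then have "eventually P (tails I le) \<longleftrightarrow> (\<exists>i\<in>I. eventually P (principal {j \<in> I. le i j}))"
    unfolding tails_def using ne by (intro eventually_INF_base) auto
  then show ?thesis
    by (auto simp: eventually_principal)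
qed

text \<open>Since HOL cannot quantify over index types inside a formula, the index sets below are sets of
  elements of type \<^typ>\<open>'a set\<close>. The lemma \<open>Omega_anyI\<close> shows that nets over an arbitrary index
  type yield no further points.\<close>

definition Omega :: "('a::topological_space \<Rightarrow> ereal) \<Rightarrow> 'a set \<Rightarrow> 'a set" where
  "Omega h K = {x \<in> K. \<exists>(I :: 'a set set) le X.
     directed_set I le \<and> (\<forall>i\<in>I. X i \<in> K) \<and>
     (X \<longlongrightarrow> x) (tails I le) \<and> ((\<lambda>i. h (X i)) \<longlongrightarrow> (INF y\<in>K. h y)) (tails I le)}"

lemma Omega_anyI:
  fixes I :: "'i set" and X :: "'i \<Rightarrow> 'a::topological_space"
  assumes x: "x \<in> K" and dir: "directed_set I le" and XK: "\<And>i. i \<in> I \<Longrightarrow> X i \<in> K"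
    and lim: "(X \<longlongrightarrow> x) (tails I le)"
    and hlim: "((\<lambda>i. h (X i)) \<longlongrightarrow> (INF y\<in>K. h y)) (tails I le)"
  shows "x \<in> Omega h K"
proof -
  define J where "J = {A. A \<subseteq> K \<and> eventually (\<lambda>i. X i \<in> A) (tails I le)}"
  define Y where "Y A = (SOME a. a \<in> A)" for A :: "'a set"
  have nonbot: "tails I le \<noteq> bot"
    using dir unfolding trivial_limit_def eventually_tails[OF dir]
    by (auto simp: directed_set_def reflp_on_def)
  have evK: "eventually (\<lambda>i. X i \<in> K) (tails I le)"
    unfolding eventually_tails[OF dir] using dir XK by (auto simp: directed_set_def)
  have Y: "Y A \<in> A" if "A \<in> J" for A
  proof -
    have "\<exists>i. X i \<in> A"
      using that eventually_happens[of "\<lambda>i. X i \<in> A"] nonbot by (auto simp: J_def)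
    then show ?thesis
      unfolding Y_def by (auto intro: someI)
  qed
  have dirJ: "directed_set J (\<supseteq>)"
    unfolding directed_set_def
  proof (intro conjI ballI)
    show "J \<noteq> {}" using evK by (auto simp: J_def)
    show "reflp_on J (\<supseteq>)" by (auto simp: reflp_on_def)
    show "transp_on J (\<supseteq>)" by (auto simp: transp_on_def)
    show "\<exists>C\<in>J. A \<supseteq> C \<and> B \<supseteq> C" if "A \<in> J" "B \<in> J" for A B
      using that by (intro bexI[of _ "A \<inter> B"]) (auto simp: J_def eventually_conj)
  qed
  have YP: "eventually (\<lambda>A. P (Y A)) (tails J (\<supseteq>))"
    if "eventually (\<lambda>i. P (X i)) (tails I le)" for P
  proof -
    have A: "{y \<in> K. P y} \<in> J"
      using that evK by (auto simp: J_def eventually_conj)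
    have "P (Y B)" if "B \<in> J" "B \<subseteq> {y \<in> K. P y}" for B
      using Y[OF that(1)] that(2) by auto
    with A show ?thesis
      unfolding eventually_tails[OF dirJ] by (intro bexI[OF _ A]) simp
  qed
  have "(Y \<longlongrightarrow> x) (tails J (\<supseteq>))"
    unfolding tendsto_def
  proof (intro allI impI)
    fix S assume "open S" "x \<in> S"
    then have "eventually (\<lambda>i. X i \<in> S) (tails I le)"
      using lim by (auto simp: tendsto_def)
    then show "eventually (\<lambda>A. Y A \<in> S) (tails J (\<supseteq>))"
      by (rule YP)
  qed
  moreover have "((\<lambda>A. h (Y A)) \<longlongrightarrow> (INF y\<in>K. h y)) (tails J (\<supseteq>))"
    unfolding tendsto_def
  proof (intro allI impI)
    fix S assume "open S" "(INF y\<in>K. h y) \<in> S"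
    then have "eventually (\<lambda>i. h (X i) \<in> S) (tails I le)"
      using hlim by (auto simp: tendsto_def)
    then show "eventually (\<lambda>A. h (Y A) \<in> S) (tails J (\<supseteq>))"
      by (rule YP)
  qed
  moreover have "\<forall>A\<in>J. Y A \<in> K"
    using Y by (auto simp: J_def)
  ultimately show ?thesis
    unfolding Omega_def using x dirJ by blast
qed

definition generalized_minimizers :: "('a::topological_space \<Rightarrow> ereal) \<Rightarrow> 'a set \<Rightarrow> 'a set" where
  "generalized_minimizers h K = closure (Omega h K)"

definition continuous_affine :: "('a::{real_vector,topological_space} \<Rightarrow> real) set" where
  "continuous_affine = {m. continuous_on UNIV m \<and>
     (\<forall>x y u v. u + v = 1 \<longrightarrow> m (u *\<^sub>R x + v *\<^sub>R y) = u * m x + v * m y)}"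

text \<open>The supremum is taken in \<^typ>\<open>ereal\<close>; it equals \<open>\<infinity>\<close> if \<open>h\<close> is identically \<open>\<infinity>\<close> on \<open>K\<close>.\<close>

definition Gamma_reg ::
    "('a::{real_vector,topological_space} \<Rightarrow> ereal) \<Rightarrow> 'a set \<Rightarrow> 'a \<Rightarrow> ereal" where
  "Gamma_reg h K x = (SUP m \<in> {m \<in> continuous_affine. \<forall>y\<in>K. ereal (m y) \<le> h y}. ereal (m x))"

definition minimizers :: "('a \<Rightarrow> ereal) \<Rightarrow> 'a set \<Rightarrow> 'a set" where
  "minimizers f K = {x \<in> K. f x = (INF y\<in>K. f y)}"

end

theory Submission
  imports Defs
begin

text \<open>Write \<open>c\<close> for the infimum of \<open>h\<close> over \<open>K\<close>, assumed finite, and \<open>\<Omega>\<close> for \<open>Omega h K\<close>.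
  Every closed convex \<open>N\<close> containing \<open>\<Omega>\<close> contains \<open>M\<close>: if a continuous linear functional
  strictly separates \<open>z \<in> M\<close> from \<open>N\<close>, then on the compact part of \<open>K\<close> on the side of \<open>z\<close> the
  function \<open>h\<close> exceeds \<open>c\<close> by a uniform amount, so tilting the constant \<open>c\<close> slightly gives an
  affine minorant of \<open>h\<close> with value above \<open>c\<close> at \<open>z\<close>. If \<open>x\<close> is extreme in \<open>M\<close> but not in the
  closure of \<open>\<Omega>\<close>, cover that compact closure by finitely many half-spaces missing \<open>x\<close>.
  The convex hull of their intersections with \<open>M\<close> is compact and contains \<open>\<Omega>\<close>, so it is \<open>M\<close>,
  and the extreme point \<open>x\<close> lies in one of the half-spaces.

  The separating functional comes from the Mazur-Orlicz form of the Hahn-Banach theorem, by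
  Zorn's lemma on sublinear functionals: a minimal one is linear, since otherwise
  \<open>x \<mapsto> inf\<^bsub>t \<ge> 0\<^esub> (q (x + t y) - t q y)\<close> would be a smaller one.\<close>

section \<open>Hahn-Banach separation\<close>

definition sublinear :: "('a::real_vector \<Rightarrow> real) \<Rightarrow> bool" where
  "sublinear p \<longleftrightarrow> (\<forall>x y. p (x + y) \<le> p x + p y) \<and> (\<forall>t x. 0 < t \<longrightarrow> p (t *\<^sub>R x) = t * p x)"

lemma sublinear_add: "sublinear p \<Longrightarrow> p (x + y) \<le> p x + p y"
  and sublinear_scale_pos: "sublinear p \<Longrightarrow> 0 < t \<Longrightarrow> p (t *\<^sub>R x) = t * p x"
  by (auto simp: sublinear_def)

lemma sublinear_0:
  assumes "sublinear p"
  shows "p 0 = 0"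
  using sublinear_scale_pos[OF assms, of 2 0] by simp

lemma sublinear_scale:
  assumes "sublinear p" "0 \<le> t"
  shows "p (t *\<^sub>R x) = t * p x"
  using assms sublinear_scale_pos[OF assms(1), of t x] sublinear_0[OF assms(1)]
  by (cases "t = 0") auto

lemma sublinear_minus:
  assumes "sublinear p"
  shows "- p (- x) \<le> p x"
  using sublinear_add[OF assms, of x "- x"] sublinear_0[OF assms] by simp

text \<open>The reverse scaling inequality is the assumed one for \<open>inverse t\<close> at
  \<open>t *\<^sub>R x\<close>.\<close>

lemma sublinearI_le:
  assumes add: "\<And>x y. p (x + y) \<le> p x + p y"
    and scale: "\<And>t x. 0 < t \<Longrightarrow> p (t *\<^sub>R x) \<le> t * p x"
  shows "sublinear p"
  unfolding sublinear_def
proof (intro conjI allI impI)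
  fix t :: real and x :: 'a
  assume t: "0 < t"
  have "p x \<le> inverse t * p (t *\<^sub>R x)"
    using scale[of "inverse t" "t *\<^sub>R x"] t by simp
  then have "t * p x \<le> p (t *\<^sub>R x)"
    using t by (simp add: field_simps)
  with scale[OF t, of x] show "p (t *\<^sub>R x) = t * p x"
    by simp
qed (rule add)

text \<open>Take \<open>q x\<close> to be the infimum of
  \<open>p (x + t *\<^sub>R c) - t * b\<close> over \<open>t \<ge> 0\<close> and
  \<open>c \<in> C\<close>. The choice \<open>t = 0\<close> gives \<open>q \<le> p\<close>, and
  \<open>t = 1\<close> at \<open>- c\<close> gives the last bound. With \<open>C = {y}\<close> and
  \<open>b = p y\<close> this is the functional that contradicts minimality of a nonlinear
  \<open>p\<close>.\<close>

lemma sublinear_lower: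
  fixes C :: "'a::real_vector set"
  assumes p: "sublinear p" and C: "convex C" "C \<noteq> {}" and b: "\<And>c. c \<in> C \<Longrightarrow> b \<le> p c"
  obtains q where "sublinear q" "\<And>x. q x \<le> p x" "\<And>c. c \<in> C \<Longrightarrow> q (- c) \<le> - b"
proof -
  define g where "g x = (\<lambda>(t, c). p (x + t *\<^sub>R c) - t * b)" for x
  define T where "T = {0::real..} \<times> C"
  define q where "q x = (INF tc\<in>T. g x tc)" for x
  have T: "T \<noteq> {}"
    using C by (auto simp: T_def)
  have bdd: "bdd_below (g x ` T)" for x
  proof (rule bdd_belowI2)
    fix tc assume "tc \<in> T"
    then obtain t c where tc: "tc = (t, c)" "0 \<le> t" "c \<in> C"
      by (auto simp: T_def)
    \<comment> \<open>The bound \<open>b \<le> p c\<close> on \<open>C\<close> is what keeps the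
      infimum finite.\<close>
    have "t * b \<le> p (t *\<^sub>R c)"
      using sublinear_scale[OF p tc(2)] b[OF tc(3)] tc(2) by (simp add: mult_left_mono)
    also have "\<dots> \<le> p (x + t *\<^sub>R c) + p (- x)"
      using sublinear_add[OF p, of "x + t *\<^sub>R c" "- x"] by simp
    finally show "- p (- x) \<le> g x tc"
      by (simp add: g_def tc)
  qed
  have q_le: "q x \<le> p (x + t *\<^sub>R c) - t * b" if "0 \<le> t" "c \<in> C" for x t c
  proof -
    have "(t, c) \<in> T" using that by (simp add: T_def)
    from cINF_lower[OF bdd this, of x] show ?thesis
      by (simp add: q_def g_def)
  qed
  have q_ge: "m \<le> q x" if "\<And>t c. 0 \<le> t \<Longrightarrow> c \<in> C \<Longrightarrow> m \<le> p (x + t *\<^sub>R c) - t * b" for m x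
    unfolding q_def by (rule cINF_greatest[OF T]) (use that in \<open>auto simp: T_def g_def\<close>)
  have key: "q (x + y) \<le> (p (x + t *\<^sub>R c) - t * b) + (p (y + s *\<^sub>R d) - s * b)"
    if "0 \<le> t" "c \<in> C" "0 \<le> s" "d \<in> C" for x y t c s d
  proof -
    \<comment> \<open>Convexity of \<open>C\<close> merges the two parameters into the single
      admissible pair \<open>(t + s, e)\<close>, which yields subadditivity of
      \<open>q\<close>.\<close>
    have "\<exists>e\<in>C. t *\<^sub>R c + s *\<^sub>R d = (t + s) *\<^sub>R e"
    proof (cases "t + s = 0")
      case True
      then have "t = 0" "s = 0" using that by auto
      then show ?thesis using that by auto
    next
      case False
      then have pos: "0 < t + s" using that by simp
      have "(t / (t + s)) *\<^sub>R c + (s / (t + s)) *\<^sub>R d \<in> C"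
        by (rule convexD[OF C(1)]) (use that pos in \<open>auto simp: add_divide_distrib[symmetric]\<close>)
      moreover have "t *\<^sub>R c + s *\<^sub>R d = (t + s) *\<^sub>R ((t / (t + s)) *\<^sub>R c + (s / (t + s)) *\<^sub>R d)"
        using pos by (simp add: scaleR_add_right)
      ultimately show ?thesis by blast
    qed
    then obtain e where e: "e \<in> C" "t *\<^sub>R c + s *\<^sub>R d = (t + s) *\<^sub>R e" by blast
    have "q (x + y) \<le> p ((x + y) + (t + s) *\<^sub>R e) - (t + s) * b"
      using that e by (intro q_le) auto
    also have "(x + y) + (t + s) *\<^sub>R e = (x + t *\<^sub>R c) + (y + s *\<^sub>R d)"
      unfolding e(2)[symmetric] by (simp add: add_ac)
    also have "p \<dots> \<le> p (x + t *\<^sub>R c) + p (y + s *\<^sub>R d)"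
      by (rule sublinear_add[OF p])
    finally show ?thesis by (simp add: algebra_simps)
  qed
  show thesis
  proof
    show "sublinear q"
    proof (rule sublinearI_le)
      fix x y
      have "q (x + y) - (p (y + s *\<^sub>R d) - s * b) \<le> q x" if "0 \<le> s" "d \<in> C" for s d
        by (rule q_ge) (use key[of _ _ s d x y] that in \<open>simp add: algebra_simps\<close>)
      then have "q (x + y) - q x \<le> q y"
        by (intro q_ge) (simp add: algebra_simps)
      then show "q (x + y) \<le> q x + q y" by simp
    next
      fix r :: real and x assume r: "0 < r"
      have "q (r *\<^sub>R x) / r \<le> q x"
      proof (rule q_ge)
        fix t :: real and c assume tc: "0 \<le> t" "c \<in> C"
        have "q (r *\<^sub>R x) \<le> p (r *\<^sub>R x + (r * t) *\<^sub>R c) - r * t * b"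
          using tc r by (intro q_le) auto
        also have "r *\<^sub>R x + (r * t) *\<^sub>R c = r *\<^sub>R (x + t *\<^sub>R c)"
          by (simp add: scaleR_add_right)
        also have "p \<dots> = r * p (x + t *\<^sub>R c)"
          by (rule sublinear_scale_pos[OF p r])
        finally show "q (r *\<^sub>R x) / r \<le> p (x + t *\<^sub>R c) - t * b"
          using r by (simp add: field_simps)
      qed
      then show "q (r *\<^sub>R x) \<le> r * q x"
        using r by (simp add: field_simps)
    qed
    obtain c0 where "c0 \<in> C" using C by blast
    then show "q x \<le> p x" for x
      using q_le[of 0 c0 x] by simp
    show "q (- c) \<le> - b" if "c \<in> C" for c
      using q_le[of 1 c "- c"] that sublinear_0[OF p] by simp
  qed
qed

text \<open>Zorn's lemma for the reversed pointwise order. A nonempty chain is bounded by its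
  pointwise infimum, which is finite because every sublinear \<open>q \<le> p\<close> satisfies
  \<open>- p (- x) \<le> - q (- x) \<le> q x\<close>.\<close>

lemma minimal_sublinear:
  fixes p :: "'a::real_vector \<Rightarrow> real"
  assumes p: "sublinear p"
  obtains q where "sublinear q" "q \<le> p" "\<And>r. sublinear r \<Longrightarrow> r \<le> q \<Longrightarrow> r = q"
proof -
  define A where "A = {q. sublinear q \<and> q \<le> p}"
  have "\<exists>m\<in>A. \<forall>a\<in>A. m \<ge> a \<longrightarrow> a = m"
  proof (rule predicate_Zorn)
    show "partial_order_on A (relation_of (\<ge>) A)"
      by (rule partial_order_on_relation_ofI) auto
  next
    fix C assume C: "C \<in> Chains (relation_of (\<ge>) A)"
    have CA: "sublinear q" "q x \<le> p x" if "q \<in> C" for q x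
      using C that by (auto simp: Chains_def relation_of_def A_def le_fun_def)
    have chain: "q \<le> r \<or> r \<le> q" if "q \<in> C" "r \<in> C" for q r
      using C that by (auto simp: Chains_def relation_of_def)
    show "\<exists>u\<in>A. \<forall>a\<in>C. a \<ge> u"
    proof (cases "C = {}")
      case True
      then show ?thesis using p by (auto simp: A_def)
    next
      case False
      define u where "u x = (INF q\<in>C. q x)" for x
      have bdd: "bdd_below ((\<lambda>q. q x) ` C)" for x
        using sublinear_minus[OF CA(1)] CA(2)
        by (intro bdd_belowI2[of _ "- p (- x)"]) (smt (verit, best))
      have u_le: "u x \<le> q x" if "q \<in> C" for q x
        unfolding u_def by (rule cINF_lower[OF bdd that])
      have u_ge: "m \<le> u x" if "\<And>q. q \<in> C \<Longrightarrow> m \<le> q x" for m x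
        unfolding u_def by (rule cINF_greatest[OF False that])
      have "sublinear u"
      proof (rule sublinearI_le)
        fix x y
        have le: "u (x + y) \<le> q x + r y" if qr: "q \<in> C" "r \<in> C" for q r
        proof -
          \<comment> \<open>Subadditivity of an infimum needs one functional for both summands; the
            smaller of \<open>q\<close> and \<open>r\<close> serves.\<close>
          from chain[OF qr] obtain s where s: "s \<in> C" "s \<le> q" "s \<le> r"
            using qr by auto
          have "u (x + y) \<le> s x + s y"
            using u_le[OF s(1), of "x + y"] sublinear_add[OF CA(1)[OF s(1)], of x y] by simp
          also have "\<dots> \<le> q x + r y"
            using s by (intro add_mono) (auto simp: le_fun_def)
          finally show ?thesis .
        qed
        have "u (x + y) - r y \<le> u x" if "r \<in> C" for r
          using le[OF _ that] by (intro u_ge) (simp add: algebra_simps)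
        then have "u (x + y) - u x \<le> u y"
          by (intro u_ge) (simp add: algebra_simps)
        then show "u (x + y) \<le> u x + u y" by simp
      next
        fix t :: real and x assume t: "0 < t"
        have "u (t *\<^sub>R x) / t \<le> u x"
        proof (rule u_ge)
          fix q assume q: "q \<in> C"
          show "u (t *\<^sub>R x) / t \<le> q x"
            using u_le[OF q, of "t *\<^sub>R x"] sublinear_scale_pos[OF CA(1)[OF q] t, of x] t
            by (simp add: field_simps)
        qed
        then show "u (t *\<^sub>R x) \<le> t * u x"
          using t by (simp add: field_simps)
      qed
      moreover have "u \<le> p"
        using False u_le CA(2) by (metis all_not_in_conv le_fun_def order_trans)
      ultimately show ?thesis
        using u_le by (auto simp: A_def le_fun_def)
    qed
  qed
  then obtain q where "q \<in> A" "\<And>r. r \<in> A \<Longrightarrow> r \<le> q \<Longrightarrow> r = q"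
    by blast
  then show thesis
    by (intro that[of q]) (auto simp: A_def)
qed

text \<open>Lowering \<open>q\<close> along \<open>{y}\<close> must return \<open>q\<close> itself,
  which forces \<open>q (- y) = - q y\<close>; an odd sublinear functional is linear.\<close>

lemma minimal_sublinear_linear:
  fixes q :: "'a::real_vector \<Rightarrow> real"
  assumes q: "sublinear q" and min: "\<And>r. sublinear r \<Longrightarrow> r \<le> q \<Longrightarrow> r = q"
  shows "linear q"
proof -
  have odd: "q (- y) = - q y" for y
  proof -
    obtain r where "sublinear r" "\<And>x. r x \<le> q x" "\<And>c. c \<in> {y} \<Longrightarrow> r (- c) \<le> - q y"
      by (rule sublinear_lower[OF q, of "{y}" "q y"]) auto
    then have "q (- y) \<le> - q y"
      using min[of r] by (auto simp: le_fun_def)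
    then show ?thesis
      using sublinear_minus[OF q, of y] by simp
  qed
  show ?thesis
  proof (rule linearI)
    show "q (x + y) = q x + q y" for x y
      using sublinear_add[OF q, of x y] sublinear_add[OF q, of "- x" "- y"] odd[of "x + y"]
      by (simp add: odd)
    show "q (t *\<^sub>R x) = t *\<^sub>R q x" for t x
      using sublinear_scale[OF q, of t x] sublinear_scale[OF q, of "- t" x] odd[of "t *\<^sub>R x"]
      by (cases "0 \<le> t") auto
  qed
qed

text \<open>The lower bound on \<open>C\<close> is first turned into the upper bound
  \<open>q (- c) \<le> - b\<close>, which survives the passage to a minimal
  \<open>f \<le> q\<close>. Linearity of \<open>f\<close> turns it back.\<close>

theorem mazur_orlicz:
  fixes C :: "'a::real_vector set"
  assumes p: "sublinear p" and C: "convex C" and b: "\<And>c. c \<in> C \<Longrightarrow> b \<le> p c"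
  obtains f where "linear f" "\<And>x. f x \<le> p x" "\<And>c. c \<in> C \<Longrightarrow> b \<le> f c"
proof -
  obtain q where q: "sublinear q" "\<And>x. q x \<le> p x" "\<And>c. c \<in> C \<Longrightarrow> q (- c) \<le> - b"
  proof (cases "C = {}")
    case True
    then show thesis using p that[of p] by simp
  next
    case False
    show thesis by (rule sublinear_lower[OF p C False b]) (use that in auto)
  qed
  obtain f where f: "sublinear f" "f \<le> q" "\<And>r. sublinear r \<Longrightarrow> r \<le> f \<Longrightarrow> r = f"
    using minimal_sublinear[OF q(1)] by blast
  have lin: "linear f" by (rule minimal_sublinear_linear[OF f(1,3)])
  have fq: "f x \<le> q x" for x using f(2) by (simp add: le_fun_def)
  show thesis
  proof
    show "f x \<le> p x" for x using fq q(2) order_trans by blast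
    show "b \<le> f c" if "c \<in> C" for c
      using fq[of "- c"] q(3)[OF that] linear_neg[OF lin, of c] by simp
  qed (rule lin)
qed

section \<open>Gauges of convex neighbourhoods and separation of a point from a closed convex
  set\<close>

lemma tendsto_scaleR_lcs:
  fixes g :: "'b \<Rightarrow> 'a::locally_convex_space"
  assumes "(f \<longlongrightarrow> r) F" "(g \<longlongrightarrow> a) F"
  shows "((\<lambda>x. f x *\<^sub>R g x) \<longlongrightarrow> r *\<^sub>R a) F"
  using filterlim_compose[OF tendsto_scaleR_Pair filterlim_Pair[OF assms]] by simp

text \<open>\<open>p\<close> is the Minkowski gauge of \<open>V\<close>. It is finite because
  \<open>(1 / t) *\<^sub>R x\<close> tends to 0 as \<open>t\<close> grows, so \<open>V\<close>
  absorbs every point.\<close>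

lemma convex_nhd_gauge:
  fixes V :: "'a::locally_convex_space set"
  assumes V: "open V" "convex V" "0 \<in> V"
  obtains p where "sublinear p" "\<And>x. x \<in> V \<Longrightarrow> p x \<le> 1" "\<And>x. x \<notin> V \<Longrightarrow> 1 \<le> p x"
proof -
  define S where "S x = {t. 0 < t \<and> (1 / t) *\<^sub>R x \<in> V}" for x
  define p where "p x = Inf (S x)" for x
  have S: "S x \<noteq> {}" for x
  proof -
    have "((\<lambda>t. (1 / t) *\<^sub>R x) \<longlongrightarrow> 0 *\<^sub>R x) (at_top :: real filter)"
      by (intro tendsto_scaleR_lcs tendsto_const) real_asymp
    then have "eventually (\<lambda>t::real. (1 / t) *\<^sub>R x \<in> V) at_top"
      using V by (auto dest: topological_tendstoD)
    then have "eventually (\<lambda>t. t \<in> S x) at_top"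
      using eventually_gt_at_top[of 0] by eventually_elim (auto simp: S_def)
    then show ?thesis
      using eventually_happens by fastforce
  qed
  have bdd: "bdd_below (S x)" for x
    by (rule bdd_belowI[of _ 0]) (auto simp: S_def)
  have p_le: "p x \<le> t" if "t \<in> S x" for x t
    unfolding p_def by (rule cInf_lower[OF that bdd])
  have p_ge: "m \<le> p x" if "\<And>t. t \<in> S x \<Longrightarrow> m \<le> t" for m x
    unfolding p_def by (rule cInf_greatest[OF S that])
  show thesis
  proof
    show "sublinear p"
    proof (rule sublinearI_le)
      fix x y
      have le: "p (x + y) \<le> t + s" if ts: "t \<in> S x" "s \<in> S y" for t s
      proof (rule p_le)
        have pos: "0 < t" "0 < s" using ts by (auto simp: S_def)
        \<comment> \<open>This convex combination of \<open>(1 / t) *\<^sub>R x\<close> and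
          \<open>(1 / s) *\<^sub>R y\<close> is
          \<open>(1 / (t + s)) *\<^sub>R (x + y)\<close>.\<close>
        have "(t / (t + s)) *\<^sub>R ((1 / t) *\<^sub>R x) + (s / (t + s)) *\<^sub>R ((1 / s) *\<^sub>R y) \<in> V"
          by (rule convexD[OF V(2)]) (use ts pos in \<open>auto simp: S_def add_divide_distrib[symmetric]\<close>)
        then show "t + s \<in> S (x + y)"
          using pos by (simp add: S_def scaleR_add_right)
      qed
      have "p (x + y) - s \<le> p x" if "s \<in> S y" for s
        using le[OF _ that] by (intro p_ge) (simp add: algebra_simps)
      then have "p (x + y) - p x \<le> p y"
        by (intro p_ge) (simp add: algebra_simps)
      then show "p (x + y) \<le> p x + p y" by simp
    next
      fix r :: real and x assume r: "0 < r"
      have "p (r *\<^sub>R x) / r \<le> p x"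
      proof (rule p_ge)
        fix t assume "t \<in> S x"
        then have "r * t \<in> S (r *\<^sub>R x)"
          using r by (simp add: S_def)
        from p_le[OF this] show "p (r *\<^sub>R x) / r \<le> t"
          using r by (simp add: field_simps)
      qed
      then show "p (r *\<^sub>R x) \<le> r * p x"
        using r by (simp add: field_simps)
    qed
    show "p x \<le> 1" if "x \<in> V" for x
      using that by (intro p_le) (simp add: S_def)
    show "1 \<le> p x" if "x \<notin> V" for x
    proof (rule p_ge, rule ccontr)
      fix t assume t: "t \<in> S x" "\<not> 1 \<le> t"
      \<comment> \<open>For \<open>t < 1\<close> the point \<open>x\<close> lies on the segment from
        0 to \<open>(1 / t) *\<^sub>R x\<close>, hence in \<open>V\<close>.\<close>
      have "t *\<^sub>R ((1 / t) *\<^sub>R x) + (1 - t) *\<^sub>R 0 \<in> V"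
        by (rule convexD[OF V(2)]) (use t V in \<open>auto simp: S_def\<close>)
      then show False using t that by (auto simp: S_def)
    qed
  qed
qed

lemma linear_continuous_lcs:
  fixes f :: "'a::locally_convex_space \<Rightarrow> real"
  assumes f: "linear f" and V: "open V" "0 \<in> V" and le: "\<And>v. v \<in> V \<Longrightarrow> f v \<le> 1"
  shows "continuous_on UNIV f"
  unfolding continuous_on_def
proof (intro ballI, rule tendstoI)
  fix x :: 'a and e :: real
  assume e: "0 < e"
  have ev: "eventually (\<lambda>y. c *\<^sub>R (y - x) \<in> V) (at x)" for c
  proof -
    have "((\<lambda>y. c *\<^sub>R (y - x)) \<longlongrightarrow> c *\<^sub>R (x - x)) (at x)"
      by (intro tendsto_scaleR_lcs tendsto_diff tendsto_const tendsto_ident_at)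
    then show ?thesis
      using V by (auto dest: topological_tendstoD)
  qed
  \<comment> \<open>\<open>V\<close> may fail to be symmetric, so both signs are used; the factor 2
    gives \<open>\<bar>f y - f x\<bar> \<le> e / 2\<close>, hence a strict bound.\<close>
  from ev[of "2 / e"] ev[of "- 2 / e"] show "eventually (\<lambda>y. dist (f y) (f x) < e) (at x)"
  proof eventually_elim
    case (elim y)
    from le[OF elim(1)] le[OF elim(2)] have "(2 / e) * (f y - f x) \<le> 1" "- (2 / e) * (f y - f x) \<le> 1"
      by (simp_all only: linear_scale[OF f] linear_diff[OF f] real_scaleR_def minus_divide_left)
    then show ?case
      using e by (simp add: dist_real_def field_simps abs_less_iff)
  qed
qed

text \<open>After translating \<open>z\<close> to 0, some convex neighbourhood \<open>V\<close> of 0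
  misses \<open>C\<close>, so its gauge is at least 1 there. \<open>mazur_orlicz\<close> with
  \<open>b = 1\<close> gives the gap, and domination by the gauge makes \<open>f\<close> at most 1
  on \<open>V\<close>, hence continuous.\<close>

lemma separation_point_closed_convex:
  fixes C :: "'a::locally_convex_space set"
  assumes C: "closed C" "convex C" and z: "z \<notin> C"
  obtains f :: "'a \<Rightarrow> real"
  where "linear f" "continuous_on UNIV f" "\<And>c. c \<in> C \<Longrightarrow> f z + 1 \<le> f c"
proof -
  have "((\<lambda>v. z + v) \<longlongrightarrow> z + 0) (nhds 0)"
    by (intro tendsto_add tendsto_const filterlim_ident)
  then have "eventually (\<lambda>v. z + v \<in> - C) (nhds 0)"
    using C z by (intro topological_tendstoD) auto
  then obtain U where U: "open U" "0 \<in> U" "\<And>v. v \<in> U \<Longrightarrow> z + v \<notin> C"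
    by (auto simp: eventually_nhds)
  obtain V where V: "open V" "convex V" "0 \<in> V" "V \<subseteq> U"
    using locally_convex_0[OF U(1,2)] by blast
  obtain p where p: "sublinear p" "\<And>x. x \<in> V \<Longrightarrow> p x \<le> 1" "\<And>x. x \<notin> V \<Longrightarrow> 1 \<le> p x"
    using convex_nhd_gauge[OF V(1-3)] by metis
  have "convex ((\<lambda>c. c - z) ` C)"
    using C(2) by (rule convex_translation_subtract)
  moreover have "1 \<le> p d" if "d \<in> (\<lambda>c. c - z) ` C" for d
    using that U(3)[of d] V(4) by (intro p(3)) auto
  ultimately obtain f where f: "linear f" "\<And>x. f x \<le> p x" "\<And>d. d \<in> (\<lambda>c. c - z) ` C \<Longrightarrow> 1 \<le> f d"
    using mazur_orlicz[OF p(1)] by blast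
  show thesis
  proof
    show "continuous_on UNIV f"
      by (rule linear_continuous_lcs[OF f(1) V(1,3)]) (use f(2) p(2) order_trans in blast)
    show "f z + 1 \<le> f c" if "c \<in> C" for c
      using f(3)[of "c - z"] that by (simp add: linear_diff[OF f(1)])
  qed (rule f(1))
qed

section \<open>Convex hulls of finitely many compact convex sets\<close>

text \<open>The hull is the image of the compact set \<open>{0..1} \<times> A \<times> B\<close>
  under a map that is continuous because scalar multiplication is jointly continuous.\<close>

lemma compact_convex_hull_Un:
  fixes A B :: "'a::locally_convex_space set"
  assumes A: "compact A" "convex A" and B: "compact B" "convex B"
  shows "compact (convex hull (A \<union> B))"
proof (cases "A = {} \<or> B = {}")
  case True
  then show ?thesis using A B by (auto simp: hull_same)
next
  case False
  \<comment> \<open>Indexing by \<open>bool\<close> makes \<open>convex_hull_finite_union\<close>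
    applicable; it asks for nonempty sets, hence the case split.\<close>
  define S where "S i = (if i then A else B)" for i
  let ?g = "\<lambda>(u, a, b). u *\<^sub>R a + (1 - u) *\<^sub>R (b::'a)"
  have "convex hull (A \<union> B) = convex hull (\<Union>(S ` UNIV))"
    by (simp add: S_def UNIV_bool Un_commute)
  also have "\<dots> = {\<Sum>i\<in>UNIV. c i *\<^sub>R s i | c s.
      (\<forall>i\<in>UNIV. c i \<ge> 0) \<and> sum c UNIV = 1 \<and> (\<forall>i\<in>UNIV. s i \<in> S i)}"
    by (rule convex_hull_finite_union) (use False A B in \<open>auto simp: S_def\<close>)
  also have "\<dots> = ?g ` ({0..1} \<times> A \<times> B)"
  proof (intro equalityI subsetI)
    fix x assume "x \<in> {\<Sum>i\<in>UNIV. c i *\<^sub>R s i | c s.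
      (\<forall>i\<in>UNIV. c i \<ge> 0) \<and> sum c UNIV = 1 \<and> (\<forall>i\<in>UNIV. s i \<in> S i)}"
    then obtain c s where cs: "x = (\<Sum>i\<in>UNIV. c i *\<^sub>R s i)" "\<And>i. c i \<ge> 0" "sum c UNIV = 1" "\<And>i. s i \<in> S i"
      by auto
    then have "s True \<in> A" "s False \<in> B" "c False = 1 - c True"
      using cs(4)[of True] cs(4)[of False] by (auto simp: S_def UNIV_bool)
    with cs(1,2) cs(2)[of False] show "x \<in> ?g ` ({0..1} \<times> A \<times> B)"
      by (intro image_eqI[of _ _ "(c True, s True, s False)"]) (auto simp: UNIV_bool add.commute)
  next
    fix x assume "x \<in> ?g ` ({0..1} \<times> A \<times> B)"
    then obtain u a b where "x = u *\<^sub>R a + (1 - u) *\<^sub>R b" "0 \<le> u" "u \<le> 1" "a \<in> A" "b \<in> B"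
      by auto
    then show "x \<in> {\<Sum>i\<in>UNIV. c i *\<^sub>R s i | c s.
      (\<forall>i\<in>UNIV. c i \<ge> 0) \<and> sum c UNIV = 1 \<and> (\<forall>i\<in>UNIV. s i \<in> S i)}"
      by (intro CollectI exI[of _ "\<lambda>i. if i then u else 1 - u"] exI[of _ "\<lambda>i. if i then a else b"])
        (auto simp: UNIV_bool S_def)
  qed
  also have "compact \<dots>"
    unfolding case_prod_unfold
    by (intro compact_continuous_image compact_Times A B compact_Icc)
      (unfold continuous_on_def, intro ballI tendsto_add tendsto_scaleR_lcs tendsto_diff tendsto_const
        tendsto_fst tendsto_snd tendsto_ident_at)
  finally show ?thesis .
qed

lemma compact_convex_hull_UN:
  fixes K :: "'i \<Rightarrow> 'a::locally_convex_space set"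
  assumes "finite I" "\<And>i. i \<in> I \<Longrightarrow> compact (K i)" "\<And>i. i \<in> I \<Longrightarrow> convex (K i)"
  shows "compact (convex hull (\<Union>i\<in>I. K i))"
  using assms
proof (induction I)
  case empty
  then show ?case by simp
next
  case (insert i I)
  have "convex hull (\<Union>j\<in>insert i I. K j) = convex hull (K i \<union> convex hull (\<Union>j\<in>I. K j))"
    using hull_Un_right[of convex "K i" "\<Union>j\<in>I. K j"] by simp
  also have "compact \<dots>"
    using insert by (intro compact_convex_hull_Un) auto
  finally show ?case .
qed

section \<open>Generalized minimizers and the regularization\<close>

text \<open>The net is indexed by pairs of a neighbourhood and a tolerance, ordered by refinement,
  and \<open>Omega_anyI\<close> admits this index type. In contrapositive form, a point of
  \<open>K\<close> outside \<open>Omega h K\<close> has a neighbourhood on which \<open>h\<close>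
  stays above \<open>c\<close> by a fixed amount.\<close>

lemma OmegaI:
  fixes h :: "'a::topological_space \<Rightarrow> ereal" and c :: real
  assumes x: "x \<in> K" and c: "(INF y\<in>K. h y) = ereal c"
    and near: "\<And>U e. open U \<Longrightarrow> x \<in> U \<Longrightarrow> 0 < e \<Longrightarrow> \<exists>y\<in>K \<inter> U. h y < ereal (c + e)"
  shows "x \<in> Omega h K"
proof -
  define I where "I = {(U, e::real). open U \<and> x \<in> U \<and> 0 < e}"
  define le where "le = (\<lambda>(U, e) (U', e'). U' \<subseteq> (U::'a set) \<and> e' \<le> (e::real))"
  define X where "X = (\<lambda>(U, e). SOME y. y \<in> K \<inter> U \<and> h y < ereal (c + e))"
  have X: "X (U, e) \<in> K \<inter> U \<and> h (X (U, e)) < ereal (c + e)" if "(U, e) \<in> I" for U e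
  proof -
    have "\<exists>y. y \<in> K \<inter> U \<and> h y < ereal (c + e)"
      using near[of U e] that by (auto simp: I_def)
    from someI_ex[OF this] show ?thesis by (simp add: X_def)
  qed
  have dir: "directed_set I le"
    unfolding directed_set_def
  proof (intro conjI ballI)
    have "(UNIV, 1) \<in> I" by (simp add: I_def)
    then show "I \<noteq> {}" by blast
    show "reflp_on I le" by (auto simp: reflp_on_def le_def)
    show "transp_on I le" by (auto simp: transp_on_def le_def)
    fix i j assume "i \<in> I" "j \<in> I"
    then show "\<exists>k\<in>I. le i k \<and> le j k"
      by (intro bexI[of _ "(fst i \<inter> fst j, min (snd i) (snd j))"]) (auto simp: I_def le_def)
  qed
  have lim: "(X \<longlongrightarrow> x) (tails I le)"
    unfolding tendsto_def eventually_tails[OF dir]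
  proof (intro allI impI)
    fix U assume U: "open U" "x \<in> U"
    then have "(U, 1) \<in> I" by (simp add: I_def)
    moreover have "X j \<in> U" if "j \<in> I" "le (U, 1) j" for j
      using X[of "fst j" "snd j"] that by (auto simp: le_def)
    ultimately show "\<exists>i\<in>I. \<forall>j\<in>I. le i j \<longrightarrow> X j \<in> U" by blast
  qed
  have hlim: "((\<lambda>i. h (X i)) \<longlongrightarrow> (INF y\<in>K. h y)) (tails I le)"
  proof (rule order_tendstoI)
    fix a assume a: "a < (INF y\<in>K. h y)"
    have "a < h (X j)" if "j \<in> I" for j
      using X[of "fst j" "snd j"] that less_INF_D[OF a, of "X j"] by auto
    then show "eventually (\<lambda>i. a < h (X i)) (tails I le)"
      using dir unfolding eventually_tails[OF dir] by (auto simp: directed_set_def)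
  next
    fix a assume "(INF y\<in>K. h y) < a"
    then obtain b where b: "c < b" "ereal b < a"
      using c ereal_dense2[of "ereal c" a] by auto
    then have i: "(UNIV, b - c) \<in> I" by (simp add: I_def)
    have "h (X j) < a" if "j \<in> I" "le (UNIV, b - c) j" for j
    proof -
      have "h (X j) < ereal (c + snd j)"
        using X[of "fst j" "snd j"] that by simp
      also have "\<dots> \<le> ereal b"
        using that by (auto simp: le_def)
      also note b(2)
      finally show ?thesis .
    qed
    with i show "eventually (\<lambda>i. h (X i) < a) (tails I le)"
      unfolding eventually_tails[OF dir] by blast
  qed
  show ?thesis
    by (rule Omega_anyI[OF x dir _ lim hlim]) (use X in auto)
qed

lemma continuous_affineI:
  fixes f :: "'a::locally_convex_space \<Rightarrow> real"
  assumes "linear f" "continuous_on UNIV f"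
  shows "(\<lambda>x. a + b * f x) \<in> continuous_affine"
  unfolding continuous_affine_def
proof (intro CollectI conjI allI impI)
  show "continuous_on UNIV (\<lambda>x. a + b * f x)"
    by (intro continuous_intros assms)
  fix x y and u v :: real
  assume uv: "u + v = 1"
  have "a = (u + v) * a" using uv by simp
  then show "a + b * f (u *\<^sub>R x + v *\<^sub>R y) = u * (a + b * f x) + v * (a + b * f y)"
    by (simp add: linear_add[OF assms(1)] linear_scale[OF assms(1)] algebra_simps)
qed

lemma const_continuous_affine: "(\<lambda>_::'a::locally_convex_space. a) \<in> continuous_affine"
  using continuous_affineI[of "\<lambda>_::'a. 0" a 0] by (simp add: linear_iff)

lemma Gamma_reg_le: "x \<in> K \<Longrightarrow> Gamma_reg h K x \<le> h x"
  unfolding Gamma_reg_def by (intro SUP_least) auto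

text \<open>Real constants below the infimum are affine minorants. The infimum may be infinite, so
  it is approached from below.\<close>

lemma INF_le_Gamma_reg:
  fixes K :: "'a::locally_convex_space set"
  shows "(INF y\<in>K. h y) \<le> Gamma_reg h K x"
proof (rule dense_le)
  fix a assume "a < (INF y\<in>K. h y)"
  then obtain b where b: "a < ereal b" "ereal b < (INF y\<in>K. h y)"
    using ereal_dense2 by blast
  have "ereal b \<le> h y" if "y \<in> K" for y
    using b(2) that by (meson INF_lower less_imp_le order_trans)
  then have "ereal b \<le> Gamma_reg h K x"
    unfolding Gamma_reg_def by (intro SUP_upper2[of "\<lambda>_. b"]) (auto intro: const_continuous_affine)
  then show "a \<le> Gamma_reg h K x"
    using b(1) by simp
qed

text \<open>\<open>h\<close> and its regularization have the same infimum. This exhibits the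
  minimizers as a sublevel set, whose closedness and convexity come from
  \<open>Gamma_reg_sublevel\<close>.\<close>

lemma minimizers_Gamma_reg:
  fixes K :: "'a::locally_convex_space set"
  shows "minimizers (Gamma_reg h K) K = {x \<in> K. Gamma_reg h K x \<le> (INF y\<in>K. h y)}"
proof -
  have "(INF y\<in>K. Gamma_reg h K y) = (INF y\<in>K. h y)"
    by (intro antisym INF_greatest INF_le_Gamma_reg INF_mono' INF_superset_mono)
      (auto intro: Gamma_reg_le INF_lower2)
  then show ?thesis
    unfolding minimizers_def using INF_le_Gamma_reg[where K = K and h = h] antisym by fastforce
qed

lemma continuous_affine_sublevel:
  fixes m :: "'a::locally_convex_space \<Rightarrow> real"
  assumes "m \<in> continuous_affine"
  shows "closed {x. ereal (m x) \<le> d}" and "convex {x. ereal (m x) \<le> d}"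
proof -
  show "closed {x. ereal (m x) \<le> d}"
    using assms by (intro closed_Collect_le continuous_on_ereal continuous_on_const)
      (simp add: continuous_affine_def)
  show "convex {x. ereal (m x) \<le> d}"
  proof (rule convexI)
    fix x y and u v :: real
    assume *: "x \<in> {x. ereal (m x) \<le> d}" "y \<in> {x. ereal (m x) \<le> d}" "0 \<le> u" "0 \<le> v" "u + v = 1"
    have "m (u *\<^sub>R x + v *\<^sub>R y) = u * m x + v * m y"
      using assms *(5) by (simp add: continuous_affine_def)
    also have "\<dots> \<le> max (m x) (m y)"
      using * by (intro convex_bound_le) auto
    finally have "ereal (m (u *\<^sub>R x + v *\<^sub>R y)) \<le> max (ereal (m x)) (ereal (m y))"
      by (auto simp: max_def split: if_splits)
    then show "u *\<^sub>R x + v *\<^sub>R y \<in> {x. ereal (m x) \<le> d}"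
      using * by (auto intro: order_trans)
  qed
qed

lemma Gamma_reg_sublevel:
  fixes K :: "'a::locally_convex_space set"
  shows "closed {x. Gamma_reg h K x \<le> d}" and "convex {x. Gamma_reg h K x \<le> d}"
proof -
  have eq: "{x. Gamma_reg h K x \<le> d} =
      (\<Inter>m\<in>{m \<in> continuous_affine. \<forall>y\<in>K. ereal (m y) \<le> h y}. {x. ereal (m x) \<le> d})"
    by (auto simp: Gamma_reg_def SUP_le_iff)
  show "closed {x. Gamma_reg h K x \<le> d}"
    unfolding eq by (intro closed_INT ballI continuous_affine_sublevel) auto
  show "convex {x. Gamma_reg h K x \<le> d}"
    unfolding eq by (intro convex_INT continuous_affine_sublevel) auto
qed

text \<open>Each inequality \<open>m (X i) \<le> h (X i)\<close> passes to the limit along the net,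
  so every affine minorant is at most the infimum at \<open>x\<close>.\<close>

lemma Omega_subset_minimizers:
  fixes K :: "'a::locally_convex_space set"
  shows "Omega h K \<subseteq> minimizers (Gamma_reg h K) K"
proof
  fix x assume "x \<in> Omega h K"
  then obtain I le X where x: "x \<in> K" and dir: "directed_set (I :: 'a set set) le"
    and XK: "\<forall>i\<in>I. X i \<in> K" and lim: "(X \<longlongrightarrow> x) (tails I le)"
    and hlim: "((\<lambda>i. h (X i)) \<longlongrightarrow> (INF y\<in>K. h y)) (tails I le)"
    unfolding Omega_def by blast
  have nonbot: "tails I le \<noteq> bot"
    using dir unfolding trivial_limit_def eventually_tails[OF dir]
    by (auto simp: directed_set_def reflp_on_def)
  have "ereal (m x) \<le> (INF y\<in>K. h y)" if m: "m \<in> continuous_affine" "\<forall>y\<in>K. ereal (m y) \<le> h y" for m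
  proof (rule tendsto_le[OF nonbot hlim])
    have "continuous_on UNIV m" using m(1) by (simp add: continuous_affine_def)
    then show "((\<lambda>i. ereal (m (X i))) \<longlongrightarrow> ereal (m x)) (tails I le)"
      by (intro tendsto_ereal continuous_on_tendsto_compose[OF _ lim]) auto
    show "eventually (\<lambda>i. ereal (m (X i)) \<le> h (X i)) (tails I le)"
      unfolding eventually_tails[OF dir] using dir XK m(2) by (auto simp: directed_set_def)
  qed
  then have "Gamma_reg h K x \<le> (INF y\<in>K. h y)"
    unfolding Gamma_reg_def by (intro SUP_least) auto
  with x show "x \<in> minimizers (Gamma_reg h K) K"
    by (simp add: minimizers_Gamma_reg)
qed

section \<open>Closed convex sets containing \<open>Omega h K\<close>, and extreme points of the set
  of minimizers\<close>

lemma minimizers_subset_closed_convex: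
  fixes K N :: "'a::locally_convex_space set" and c :: real
  assumes K: "compact K" and c: "(INF y\<in>K. h y) = ereal c"
    and N: "closed N" "convex N" "Omega h K \<subseteq> N"
  shows "minimizers (Gamma_reg h K) K \<subseteq> N"
proof (rule subsetI, rule ccontr)
  fix z assume z: "z \<in> minimizers (Gamma_reg h K) K" and "z \<notin> N"
  then obtain f :: "'a \<Rightarrow> real" where f: "linear f" "continuous_on UNIV f"
      "\<And>y. y \<in> N \<Longrightarrow> f z + 1 \<le> f y"
    using separation_point_closed_convex[OF N(1,2)] by blast
  \<comment> \<open>The cut is at half of the gap 1: \<open>L\<close> misses \<open>N\<close>, hence
    \<open>Omega h K\<close>, while \<open>f z\<close> stays strictly below the threshold.\<close>
  define L where "L = K \<inter> {y. f y \<le> f z + 1 / 2}"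
  have "compact L"
    unfolding L_def by (intro compact_Int_closed K closed_Collect_le f continuous_on_const)
  have "\<exists>U e. open U \<and> w \<in> U \<and> 0 < e \<and> (\<forall>y\<in>K \<inter> U. ereal (c + e) \<le> h y)" if "w \<in> L" for w
  proof -
    have "w \<in> K" "w \<notin> Omega h K"
      using that f(3)[of w] N(3) by (auto simp: L_def)
    then show ?thesis
      using OmegaI[OF _ c, of w] by (meson not_le)
  qed
  then obtain U e where Ue: "\<And>w. w \<in> L \<Longrightarrow> open (U w)" "\<And>w. w \<in> L \<Longrightarrow> w \<in> U w"
      "\<And>w. w \<in> L \<Longrightarrow> 0 < e w" "\<And>w y. w \<in> L \<Longrightarrow> y \<in> K \<inter> U w \<Longrightarrow> ereal (c + e w) \<le> h y"
    by metis
  obtain F where F: "F \<subseteq> L" "finite F" "L \<subseteq> (\<Union>w\<in>F. U w)"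
    by (rule compactE_image[OF \<open>compact L\<close>, of L U]) (use Ue(1,2) in auto)
  \<comment> \<open>The finite subcover makes the excess of \<open>h\<close> over \<open>c\<close>
    uniform on \<open>L\<close>; inserting 1 keeps \<open>Min\<close> well behaved without
    discussing whether \<open>F\<close> is empty.\<close>
  define d where "d = Min (insert 1 (e ` F))"
  have d: "0 < d" "\<And>w. w \<in> F \<Longrightarrow> d \<le> e w"
    using F Ue(3) by (auto simp: d_def)
  have hL: "ereal (c + d) \<le> h y" if y: "y \<in> L" for y
  proof -
    obtain w where w: "w \<in> F" "y \<in> U w" using F(3) y by blast
    have "ereal (c + d) \<le> ereal (c + e w)" using d(2)[OF w(1)] by simp
    also have "\<dots> \<le> h y" using w y F(1) by (intro Ue(4)) (auto simp: L_def)
    finally show ?thesis .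
  qed
  have "bounded (f ` K)"
    using K f(2) by (intro compact_imp_bounded compact_continuous_image) (auto intro: continuous_on_subset)
  then obtain B0 where B0: "\<And>y. y \<in> K \<Longrightarrow> \<bar>f y\<bar> \<le> B0"
    by (auto simp: bounded_iff)
  define B where "B = \<bar>f z\<bar> + 1 + \<bar>B0\<bar>"
  have B: "0 < B" "f z + 1 / 2 - f y \<le> B" if "y \<in> K" for y
    using B0[OF that] by (auto simp: B_def)
  \<comment> \<open>The slope \<open>d / B\<close> keeps the tilt at most \<open>d\<close> on
    \<open>K\<close>, so \<open>m \<le> c + d \<le> h\<close> on \<open>L\<close>; on the rest of
    \<open>K\<close> the tilt is negative and \<open>m \<le> c \<le> h\<close>. At \<open>z\<close>
    the value is \<open>c + d / (2 * B)\<close>, above \<open>c\<close>.\<close>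
  define m where "m y = (c + d / B * (f z + 1 / 2)) + - (d / B) * f y" for y
  have m_eq: "m y = c + d / B * (f z + 1 / 2 - f y)" for y
    by (simp add: m_def algebra_simps)
  have zK: "z \<in> K" using z by (simp add: minimizers_def)
  have m: "ereal (m y) \<le> h y" if y: "y \<in> K" for y
  proof (cases "f y \<le> f z + 1 / 2")
    case True
    have "d / B * (f z + 1 / 2 - f y) \<le> d / B * B"
      using B[OF y] d(1) by (intro mult_left_mono) auto
    then have "ereal (m y) \<le> ereal (c + d)"
      using B[OF y] by (simp add: m_eq)
    also have "\<dots> \<le> h y" using hL y True by (simp add: L_def)
    finally show ?thesis .
  next
    case False
    then have "d / B * (f z + 1 / 2 - f y) \<le> 0"
      using B(1)[OF y] d(1) by (intro mult_nonneg_nonpos) auto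
    then have "ereal (m y) \<le> ereal c"
      by (simp add: m_eq)
    also have "\<dots> \<le> h y" using INF_lower[OF y, of h] c by simp
    finally show ?thesis .
  qed
  have "m \<in> continuous_affine"
    unfolding m_def by (rule continuous_affineI[OF f(1,2)])
  then have "ereal (m z) \<le> Gamma_reg h K z"
    unfolding Gamma_reg_def using m by (intro SUP_upper) auto
  also have "\<dots> \<le> ereal c"
    using z by (simp add: minimizers_Gamma_reg c)
  finally show False
    using B(1)[OF zK] d(1) by (simp add: m_eq divide_le_0_iff)
qed

lemma extreme_points_minimizers:
  fixes K :: "'a::locally_convex_space set" and c :: real
  assumes K: "compact K" "convex K" and c: "(INF y\<in>K. h y) = ereal c"
    and x: "x extreme_point_of minimizers (Gamma_reg h K) K"
  shows "x \<in> closure (Omega h K)"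
proof (rule ccontr)
  assume xO: "x \<notin> closure (Omega h K)"
  define M where "M = minimizers (Gamma_reg h K) K"
  have M: "M = K \<inter> {y. Gamma_reg h K y \<le> ereal c}"
    by (auto simp: M_def minimizers_Gamma_reg c)
  have "closed M" "compact M" "convex M"
    unfolding M using K Gamma_reg_sublevel[of h K "ereal c"]
    by (auto intro: closed_Int compact_imp_closed compact_Int_closed convex_Int)
  have OM: "closure (Omega h K) \<subseteq> M"
    using Omega_subset_minimizers[of h K] \<open>closed M\<close> by (simp add: M_def closure_minimal)
  have "\<exists>f :: 'a \<Rightarrow> real. linear f \<and> continuous_on UNIV f \<and> f x + 1 \<le> f y"
    if "y \<in> closure (Omega h K)" for y
    by (rule separation_point_closed_convex[of "{y}" x]) (use that xO in auto)
  then obtain f where f: "\<And>y. y \<in> closure (Omega h K) \<Longrightarrow> linear (f y :: 'a \<Rightarrow> real)"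
      "\<And>y. y \<in> closure (Omega h K) \<Longrightarrow> continuous_on UNIV (f y)"
      "\<And>y. y \<in> closure (Omega h K) \<Longrightarrow> f y x + 1 \<le> f y y"
    by metis
  \<comment> \<open>The open half-spaces \<open>H y\<close> provide the cover and the closed ones in
    \<open>P y\<close> preserve compactness; both exclude \<open>x\<close>.\<close>
  define H where "H y = {w. f y x + 1 / 2 < f y w}" for y
  define P where "P y = M \<inter> {w. f y x + 1 / 2 \<le> f y w}" for y
  have "compact (closure (Omega h K))"
    using compact_Int_closed[OF \<open>compact M\<close> closed_closure, of "Omega h K"] OM
    by (simp add: Int_absorb1)
  then obtain Y where Y: "Y \<subseteq> closure (Omega h K)" "finite Y" "closure (Omega h K) \<subseteq> (\<Union>y\<in>Y. H y)"
  proof (rule compactE_image)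
    show "open (H y)" if "y \<in> closure (Omega h K)" for y
      unfolding H_def by (intro open_Collect_less continuous_on_const f(2) that)
    show "closure (Omega h K) \<subseteq> (\<Union>y\<in>closure (Omega h K). H y)"
      using f(3) by (force simp: H_def)
  qed
  define N where "N = convex hull (\<Union>y\<in>Y. P y)"
  have "compact N"
    unfolding N_def
  proof (rule compact_convex_hull_UN[OF Y(2)])
    fix y assume "y \<in> Y"
    then have y: "y \<in> closure (Omega h K)" using Y(1) by blast
    show "compact (P y)"
      unfolding P_def by (intro compact_Int_closed \<open>compact M\<close> closed_Collect_le continuous_on_const f(2) y)
    have "{w. f y x + 1 / 2 \<le> f y w} = f y -` {f y x + 1 / 2..}" by auto
    then show "convex (P y)"
      unfolding P_def by (auto intro!: convex_Int \<open>convex M\<close> convex_linear_vimage f(1) y)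
  qed
  have "Omega h K \<subseteq> (\<Union>y\<in>Y. P y)"
  proof
    fix w assume w: "w \<in> Omega h K"
    then have "w \<in> closure (Omega h K)" using closure_subset by blast
    with Y(3) OM show "w \<in> (\<Union>y\<in>Y. P y)"
      by (force simp: H_def P_def)
  qed
  then have "M \<subseteq> N"
    unfolding M_def using \<open>compact N\<close>
    by (intro minimizers_subset_closed_convex[OF K(1) c])
      (auto simp: N_def compact_imp_closed intro: hull_inc)
  moreover have "N \<subseteq> M"
    unfolding N_def using \<open>convex M\<close> by (intro hull_minimal) (auto simp: P_def)
  ultimately have "M = N" by (rule subset_antisym)
  \<comment> \<open>As in Milman's theorem: an extreme point of a convex hull belongs to the
    generating set, but every \<open>P y\<close> excludes \<open>x\<close>.\<close>
  then have "x extreme_point_of convex hull (\<Union>y\<in>Y. P y)"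
    using x by (simp only: M_def N_def)
  then have "x \<in> (\<Union>y\<in>Y. P y)"
    by (rule extreme_point_of_convex_hull)
  then show False by (auto simp: P_def)
qed

text \<open>Here \<open>h\<close> is identically \<open>\<infinity>\<close> on \<open>K\<close>, so
  constant nets over a one-point index set suffice.\<close>

lemma Omega_top:
  assumes "(INF y\<in>K. h y) = \<infinity>"
  shows "Omega h K = K"
proof -
  have "x \<in> Omega h K" if "x \<in> K" for x
  proof (rule Omega_anyI[OF that])
    show "directed_set {()} (\<lambda>_ _. True)"
      by (auto simp: directed_set_def reflp_on_def transp_on_def)
    have "h x = \<infinity>" using INF_lower[OF that, of h] assms by simp
    then show "((\<lambda>_. h x) \<longlongrightarrow> (INF y\<in>K. h y)) (tails {()} (\<lambda>_ _. True))"
      using assms by simp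
  qed (auto simp: that)
  then show ?thesis by (auto simp: Omega_def)
qed

theorem theorem1p5:
  fixes K :: "'a::locally_convex_space set" and h :: "'a \<Rightarrow> ereal" and k :: real and M :: "'a set"
  assumes "K \<noteq> {}" and "compact K" and "convex K"
    and "\<And>x. x \<in> K \<Longrightarrow> ereal k \<le> h x"
    and "M = minimizers (Gamma_reg h K) K"
  shows "compact M \<and> convex M \<and> {x. x extreme_point_of M} \<subseteq> generalized_minimizers h K"
proof -
  have M: "M = K \<inter> {x. Gamma_reg h K x \<le> (INF y\<in>K. h y)}"
    using assms(5) by (auto simp: minimizers_Gamma_reg)
  have "compact M" "convex M"
    unfolding M by (intro compact_Int_closed convex_Int Gamma_reg_sublevel assms)+
  moreover have "x \<in> generalized_minimizers h K" if x: "x extreme_point_of M" for x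
    unfolding generalized_minimizers_def
  \<comment> \<open>The separation argument needs a real infimum. The value
    \<open>\<infinity>\<close> makes \<open>Omega h K\<close> all of \<open>K\<close>, and the lower
    bound \<open>k\<close> excludes \<open>-\<infinity>\<close>.\<close>
  proof (cases "INF y\<in>K. h y")
    case (real c)
    then show "x \<in> closure (Omega h K)"
      using extreme_points_minimizers assms(2,3,5) x by blast
  next
    case PInf
    have "x \<in> K" using x M by (simp add: extreme_point_of_def)
    then show "x \<in> closure (Omega h K)"
      using Omega_top[OF PInf] closure_subset by blast
  next
    case MInf
    have "ereal k \<le> (INF y\<in>K. h y)"
      by (intro INF_greatest assms(4))
    with MInf show "x \<in> closure (Omega h K)" by simp
  qed
  ultimately show ?thesis by blast
qed

end
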